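(* Let $m,n$ be positive integers, let $X\subseteq\mathbb{R}^n$ be a nonempty closed convex set with $0\in X$ and let $\mathcal{A}\in\mathbb{T}_{m,n}$ be a strictly positive definite tensor on $X$. Then, for any given $q\in\mathbb{R}^n$, TVI$(X,\mathcal{A},q)$ has a unique solution.
   Context: $\mathbb{T}_{m,n}$ denotes the set of all $m$-order $n$-dimensional real tensors $\mathcal{A}=(a_{i_1i_2\cdots i_m})$, with $i_1,\ldots,i_m\in[n]:=\{1,\ldots,n\}$. For $x\in\mathbb{R}^n$, $\mathcal{A}x^{m-1}\in\mathbb{R}^n$ is the vector with components $(\mathcal{A}x^{m-1})_i=\sum_{i_2,\ldots,i_m=1}^n a_{ii_2\cdots i_m}x_{i_2}\cdots x_{i_m}$. $\mathcal{A}$ is strictly positive definite on $X$ if $(x-y)^\top(\mathcal{A}x^{m-1}-\mathcal{A}y^{m-1})>0$ for all $x,y\in X$ with $x\neq y$. TVI$(X,\mathcal{A},q)$ is the problem of finding $x^*\in X$ such that $\langle y-x^*,\mathcal{A}(x^* )^{m-1}+q\rangle\ge 0$ for all $y\in X$. *)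

theory Defs
  imports "HOL-Analysis.Analysis"
begin

text \<open>
  The dimension $n$ is the cardinality of the index type \<open>'n\<close>.  An entry of a tensor is addressed by
  the list \<open>[i\<^sub>1, \<dots>, i\<^sub>m]\<close> of its indices; the entries at lists of length other than \<open>m\<close> carry no
  meaning and are fixed to \<open>0\<close>, so that \<open>tensors m\<close> is in bijection with the real arrays of order \<open>m\<close>.
\<close>

type_synonym 'n tensor = "'n list \<Rightarrow> real"

definition tensors :: "nat \<Rightarrow> 'n::finite tensor set" where
  "tensors m = {A. \<forall>is. length is \<noteq> m \<longrightarrow> A is = 0}"

text \<open>
  The vector $\mathcal{A}x^{m-1}$; the list \<open>is\<close> stands for $(i_2, \ldots, i_m)$.  Meaningful for
  \<open>m \<ge> 1\<close> only, since \<open>m - 1\<close> is truncated subtraction.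
\<close>

definition tensor_apply :: "nat \<Rightarrow> 'n::finite tensor \<Rightarrow> real ^ 'n \<Rightarrow> real ^ 'n" where
  "tensor_apply m A x = (\<chi> i. \<Sum>is | length is = m - 1. A (i # is) * (\<Prod>j\<leftarrow>is. x $ j))"

definition strictly_positive_definite_on ::
    "nat \<Rightarrow> 'n::finite tensor \<Rightarrow> (real ^ 'n) set \<Rightarrow> bool" where
  "strictly_positive_definite_on m A X \<longleftrightarrow>
     (\<forall>x\<in>X. \<forall>y\<in>X. x \<noteq> y \<longrightarrow> (x - y) \<bullet> (tensor_apply m A x - tensor_apply m A y) > 0)"

definition is_TVI_solution ::
    "nat \<Rightarrow> (real ^ 'n) set \<Rightarrow> 'n::finite tensor \<Rightarrow> real ^ 'n \<Rightarrow> real ^ 'n \<Rightarrow> bool" where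
  "is_TVI_solution m X A q x \<longleftrightarrow>
     x \<in> X \<and> (\<forall>y\<in>X. (y - x) \<bullet> (tensor_apply m A x + q) \<ge> 0)"

end

theory Submission imports Defs begin

text \<open>
  Write $F(x) = \mathcal{A}x^{m-1}$.  Strict monotonicity gives uniqueness.  For $m = 1$ the map $F$
  is constant, which forces $X = \{0\}$.  For $m \ge 2$ we have $F(0) = 0$, so $x^\top F(x) > 0$ for
  $0 \ne x \in X$; since $0 \in X$ and $X$ is convex, the radial projection to the unit sphere of a
  point of $X$ outside the unit ball stays in $X$, and homogeneity turns the minimum of
  $x^\top F(x)$ on the compact set of unit vectors of $X$ into coercivity of $F$ on $X$.  A solution
  on $X$ intersected with a large ball exists by Brouwer, and coercivity keeps it away from the
  boundary of the ball, so that it solves the problem on all of $X$.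
\<close>

text \<open>Solutions are the fixed points of $x \mapsto P_K(x - G(x))$.\<close>

lemma variational_inequality_compact:
  fixes G :: "'a::euclidean_space \<Rightarrow> 'a"
  assumes "compact K" "convex K" "K \<noteq> {}" "continuous_on K G"
  obtains x where "x \<in> K" "\<And>y. y \<in> K \<Longrightarrow> (y - x) \<bullet> G x \<ge> 0"
proof -
  let ?f = "\<lambda>x. closest_point K (x - G x)"
  have cl: "closed K"
    using assms(1) by (rule compact_imp_closed)
  have "continuous_on K ?f"
    by (rule continuous_on_compose2[OF continuous_on_closest_point[OF assms(2) cl assms(3), of UNIV]])
       (auto intro!: continuous_intros assms(4))
  moreover have "?f \<in> K \<rightarrow> K"
    using closest_point_in_set[OF cl assms(3)] by auto
  ultimately obtain x where x: "x \<in> K" "?f x = x"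
    by (rule brouwer[OF assms(1,2,3)])
  \<comment> \<open>Since \<open>x\<close> is the projection of \<open>x - G x\<close>, the obtuse
    angle criterion reads \<open>(x - G x - x) \<bullet> (y - x) \<le> 0\<close>.\<close>
  have "(y - x) \<bullet> G x \<ge> 0" if "y \<in> K" for y
    using closest_point_dot[OF assms(2) cl that, of "x - G x"] x(2)
    by (simp add: inner_commute)
  with x(1) show thesis
    by (rule that)
qed

lemma variational_inequality_coercive:
  fixes G :: "'a::euclidean_space \<Rightarrow> 'a"
  assumes "closed X" "convex X" "0 \<in> X" "continuous_on X G" "R > 0"
    and coercive: "\<And>x. x \<in> X \<Longrightarrow> norm x \<ge> R \<Longrightarrow> x \<bullet> G x > 0"
  obtains x where "x \<in> X" "\<And>y. y \<in> X \<Longrightarrow> (y - x) \<bullet> G x \<ge> 0"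
proof -
  let ?K = "X \<inter> cball 0 R"
  have "compact ?K" "convex ?K" "0 \<in> ?K" "continuous_on ?K G"
    using assms by (auto intro: closed_Int_compact convex_Int continuous_on_subset)
  then obtain x where x: "x \<in> ?K" and le: "\<And>y. y \<in> ?K \<Longrightarrow> (y - x) \<bullet> G x \<ge> 0"
    using variational_inequality_compact[of ?K G] by blast
  \<comment> \<open>The test point \<open>0\<close> gives \<open>x \<bullet> G x \<le> 0\<close>,
    contrary to coercivity if \<open>norm x \<ge> R\<close>.\<close>
  have "norm x < R"
    using le[OF \<open>0 \<in> ?K\<close>] coercive[of x] x by force
  have "(y - x) \<bullet> G x \<ge> 0" if y: "y \<in> X" for y
  proof -
    \<comment> \<open>A step towards \<open>y\<close> that stays in the ball and on the segment; the
      \<open>+ 1\<close> avoids a zero denominator when \<open>y = x\<close>.\<close>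
    define t where "t = min 1 ((R - norm x) / (norm (y - x) + 1))"
    have t: "0 < t" "t \<le> 1"
      using \<open>norm x < R\<close> by (auto simp: t_def intro!: divide_pos_pos add_nonneg_pos)
    have "t * norm (y - x) \<le> (R - norm x) / (norm (y - x) + 1) * (norm (y - x) + 1)"
      using \<open>norm x < R\<close> t by (intro mult_mono) (auto simp: t_def)
    also have "\<dots> = R - norm x"
      using norm_ge_zero[of "y - x"] by (simp add: add_nonneg_eq_0_iff)
    finally have "norm (x + t *\<^sub>R (y - x)) \<le> R"
      using norm_triangle_ineq[of x "t *\<^sub>R (y - x)"] t by simp
    moreover have "x + t *\<^sub>R (y - x) \<in> X"
      using convexD_alt[OF assms(2), of x y t] x y t by (simp add: algebra_simps)
    ultimately have "t * ((y - x) \<bullet> G x) \<ge> 0"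
      using le[of "x + t *\<^sub>R (y - x)"] by simp
    with t show ?thesis
      by (simp add: zero_le_mult_iff)
  qed
  with x show thesis
    using that by blast
qed

lemma continuous_on_prod_list_component:
  "continuous_on S (\<lambda>x::real^'n. \<Prod>j\<leftarrow>is. x $ j)"
  by (induction "is") (auto intro!: continuous_intros)

lemma continuous_on_tensor_apply: "continuous_on S (tensor_apply m A)"
  unfolding tensor_apply_def
  by (intro continuous_intros continuous_on_prod_list_component)

lemma prod_list_component_scaleR:
  "(\<Prod>j\<leftarrow>is. (r *\<^sub>R x :: real^'n) $ j) = r ^ length is * (\<Prod>j\<leftarrow>is. x $ j)"
  by (induction "is") auto

lemma tensor_apply_scaleR:
  "tensor_apply m A (r *\<^sub>R x) = r ^ (m - 1) *\<^sub>R tensor_apply m A x"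
  unfolding tensor_apply_def prod_list_component_scaleR
  by (auto simp: vec_eq_iff sum_distrib_left intro!: sum.cong)

text \<open>Growth is of order \<open>m\<close> by homogeneity; a quadratic lower bound already
  dominates the linear term \<open>x \<bullet> q\<close>.\<close>

lemma tensor_coercive:
  fixes X :: "(real ^ 'n::finite) set"
  assumes "m \<ge> 2" "closed X" "convex X" "0 \<in> X" "strictly_positive_definite_on m A X"
  obtains c where "c > 0"
    "\<And>x. x \<in> X \<Longrightarrow> norm x \<ge> 1 \<Longrightarrow> x \<bullet> tensor_apply m A x \<ge> c * (norm x)\<^sup>2"
proof -
  let ?F = "tensor_apply m A" and ?S = "X \<inter> sphere 0 1"
  have F0: "?F 0 = 0"
    using tensor_apply_scaleR[of m A 0 0] assms(1) by (simp add: zero_power)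
  have pos: "x \<bullet> ?F x > 0" if "x \<in> X" "x \<noteq> 0" for x
    using assms(4,5) that F0 unfolding strictly_positive_definite_on_def by force
  have "compact ?S"
    using assms(2) by (intro closed_Int_compact) auto
  moreover have "continuous_on ?S (\<lambda>x. x \<bullet> ?F x)"
    by (intro continuous_intros continuous_on_tensor_apply)
  ultimately have attained: "\<exists>u\<in>?S. \<forall>x\<in>?S. u \<bullet> ?F u \<le> x \<bullet> ?F x" if "?S \<noteq> {}"
    using that by (intro continuous_attains_inf)
  then obtain c where c: "c > 0" "\<And>u. u \<in> ?S \<Longrightarrow> c \<le> u \<bullet> ?F u"
  proof (cases "?S = {}")
    case True
    \<comment> \<open>With no unit vector in \<open>X\<close> the bound is vacuous, so any positive
      constant serves.\<close>
    then show ?thesis using that[of 1] by auto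
  next
    case False
    then obtain u where "u \<in> ?S" "\<forall>x\<in>?S. u \<bullet> ?F u \<le> x \<bullet> ?F x"
      using attained by blast
    then show ?thesis using that[of "u \<bullet> ?F u"] pos[of u] by force
  qed
  have "x \<bullet> ?F x \<ge> c * (norm x)\<^sup>2" if x: "x \<in> X" "norm x \<ge> 1" for x
  proof -
    define u where "u = (1 / norm x) *\<^sub>R x"
    have xu: "x = norm x *\<^sub>R u"
      using x by (auto simp: u_def)
    \<comment> \<open>\<open>u\<close> is the convex combination of \<open>0\<close> and
      \<open>x\<close> with weight \<open>1 / norm x \<le> 1\<close> on \<open>x\<close>.\<close>
    have "u \<in> X"
      using convexD_alt[OF assms(3,4) x(1), of "1 / norm x"] x(2) by (simp add: u_def divide_le_eq)
    moreover have "norm u = 1"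
      using x(2) by (auto simp: u_def)
    ultimately have cu: "c \<le> u \<bullet> ?F u"
      using c(2) by simp
    have "x \<bullet> ?F x = (norm x *\<^sub>R u) \<bullet> ?F (norm x *\<^sub>R u)"
      using xu by simp
    also have "\<dots> = norm x ^ Suc (m - 1) * (u \<bullet> ?F u)"
      by (simp add: tensor_apply_scaleR)
    also have "Suc (m - 1) = m"
      using assms(1) by simp
    finally have "x \<bullet> ?F x = norm x ^ m * (u \<bullet> ?F u)" .
    \<comment> \<open>The exponent drops from \<open>m\<close> to 2 because
      \<open>norm x \<ge> 1\<close> and \<open>m \<ge> 2\<close>.\<close>
    moreover have "(norm x)\<^sup>2 * c \<le> norm x ^ m * (u \<bullet> ?F u)"
      using cu c(1) x(2) assms(1) by (intro mult_mono power_increasing) auto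
    ultimately show ?thesis
      by (simp add: mult.commute)
  qed
  with c(1) show thesis
    by (rule that)
qed

text \<open>Testing each solution against the other and adding cancels \<open>q\<close> and
  contradicts strict monotonicity.\<close>

lemma TVI_solution_unique:
  assumes "strictly_positive_definite_on m A X"
    and "is_TVI_solution m X A q x" "is_TVI_solution m X A q y"
  shows "x = y"
proof (rule ccontr)
  assume "x \<noteq> y"
  then have "(x - y) \<bullet> (tensor_apply m A x - tensor_apply m A y) > 0"
    using assms unfolding strictly_positive_definite_on_def is_TVI_solution_def by blast
  moreover have "(y - x) \<bullet> (tensor_apply m A x + q) \<ge> 0" "(x - y) \<bullet> (tensor_apply m A y + q) \<ge> 0"
    using assms(2,3) unfolding is_TVI_solution_def by auto
  ultimately show False
    by (simp add: inner_diff_left inner_diff_right inner_add_right)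
qed

lemma TVI_solution_exists:
  fixes X :: "(real ^ 'n::finite) set"
  assumes "closed X" "convex X" "0 \<in> X" "strictly_positive_definite_on m A X"
  shows "\<exists>x. is_TVI_solution m X A q x"
proof (cases "m \<ge> 2")
  case True
  then obtain c where c: "c > 0"
    "\<And>x. x \<in> X \<Longrightarrow> norm x \<ge> 1 \<Longrightarrow> x \<bullet> tensor_apply m A x \<ge> c * (norm x)\<^sup>2"
    using tensor_coercive[OF _ assms] by blast
  \<comment> \<open>Chosen so that \<open>c * R = c + norm q\<close>, strictly above
    \<open>norm q\<close>.\<close>
  define R where "R = 1 + norm q / c"
  have "R \<ge> 1"
    using c(1) by (simp add: R_def)
  have "x \<bullet> (tensor_apply m A x + q) > 0" if x: "x \<in> X" "norm x \<ge> R" for x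
  proof -
    have "norm q < c * R"
      using c(1) by (simp add: R_def field_simps)
    also have "\<dots> \<le> c * norm x"
      using c(1) x(2) by simp
    finally have "norm x * norm q < norm x * (c * norm x)"
      using x(2) \<open>R \<ge> 1\<close> by (intro mult_strict_left_mono) auto
    then have "norm x * norm q < x \<bullet> tensor_apply m A x"
      using c(2)[of x] x \<open>R \<ge> 1\<close> by (simp add: power2_eq_square mult_ac)
    moreover have "x \<bullet> q \<ge> - (norm x * norm q)"
      using Cauchy_Schwarz_ineq2[of x q] by linarith
    ultimately show ?thesis
      by (simp add: inner_add_right)
  qed
  moreover have "continuous_on X (\<lambda>x. tensor_apply m A x + q)"
    by (intro continuous_intros continuous_on_tensor_apply)
  moreover have "R > 0"
    using \<open>R \<ge> 1\<close> by simp
  ultimately obtain x where "x \<in> X" "\<And>y. y \<in> X \<Longrightarrow> (y - x) \<bullet> (tensor_apply m A x + q) \<ge> 0"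
    using variational_inequality_coercive[OF assms(1-3)] by metis
  then show ?thesis
    unfolding is_TVI_solution_def by blast
next
  case False
  \<comment> \<open>Here \<open>m - 1 = 0\<close>, and \<open>0 ^ 0 = 1\<close>, so scaling
    \<open>x\<close> by \<open>0\<close> leaves the value unchanged.\<close>
  then have const: "tensor_apply m A x = tensor_apply m A 0" for x
    using tensor_apply_scaleR[of m A 0 x] by simp
  \<comment> \<open>For \<open>x \<noteq> 0\<close>, strict monotonicity against \<open>0\<close>
    would read \<open>x \<bullet> 0 > 0\<close>.\<close>
  have "x = 0" if "x \<in> X" for x
    using assms(3,4) that const[of x] unfolding strictly_positive_definite_on_def by force
  then show ?thesis
    using assms(3) unfolding is_TVI_solution_def by fastforce
qed

theorem theorem4p3:
  fixes m :: nat and X :: "(real ^ 'n::finite) set" and A :: "'n tensor" and q :: "real ^ 'n"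
  assumes "m \<ge> 1"
    and "X \<noteq> {}" and "closed X" and "convex X" and "0 \<in> X"
    and "A \<in> tensors m"
    and "strictly_positive_definite_on m A X"
  shows "\<exists>!x. is_TVI_solution m X A q x"
  using TVI_solution_exists[OF assms(3,4,5,7)] TVI_solution_unique[OF assms(7)] by blast

end
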